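(* Let $p$ be a prime and $q=p^e$. Let $L_m(q)$ be the bipartite graph whose vertex set is the disjoint union of a point set $\mathbb{F}_q^{m+1}$ and a line set $\mathbb{F}_q^{m+1}$, with a point $P=(p_1,\dots,p_{m+1})$ adjacent to a line $L=[l_1,\dots,l_{m+1}]$ if and only if $l_k+p_k=p_1^{\,p^{k-2}}\,l_1$ for all $k=2,\dots,m+1$. Suppose either ($m\ge1$, $e\ge1$ and $p$ is odd) or ($m=1$, $e\ge2$ and $p=2$). Then the girth of $L_m(q)$ is $6$.
   Context: The girth is the length of a shortest cycle in the graph. *)

theory Defs
  imports
    "Graph_Theory.Pair_Digraph"
    "HOL-Library.Extended_Nat"
    "HOL-Library.FuncSet"
    "HOL-Library.Cardinality"
    "HOL-Computational_Algebra.Primes"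
begin

text \<open>
  Undirected graphs are the symmetric digraphs of locale \<^locale>\<open>graph\<close>. There a
  traversal \<open>a, b, a\<close> of a single edge counts as a \<open>cycle\<close>, so the cycles of the
  undirected graph are exactly the library cycles of length at least 3. The girth of an
  acyclic graph is \<open>\<infinity>\<close>. The definition is meant for graphs without loops and
  parallel edges.
\<close>

definition girth :: "('v, 'b) pre_digraph \<Rightarrow> enat" where
  "girth G = (INF c \<in> {c. pre_digraph.cycle G c \<and> length c \<ge> 3}. enat (length c))"

text \<open>Coordinate vectors indexed by \<open>1, \<dots>, n\<close>, as extensional functions.\<close>

definition coord_space :: "nat \<Rightarrow> (nat \<Rightarrow> 'a) set" where
  "coord_space n = {1..n} \<rightarrow>\<^sub>E UNIV"

definition incident :: "nat \<Rightarrow> nat \<Rightarrow> (nat \<Rightarrow> 'a::field) \<Rightarrow> (nat \<Rightarrow> 'a) \<Rightarrow> bool" where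
  "incident p m P L \<longleftrightarrow> (\<forall>k \<in> {2..m+1}. L k + P k = P 1 ^ (p ^ (k - 2)) * L 1)"

text \<open>
  The base field is the type \<open>'a\<close>; points are tagged with \<^const>\<open>Inl\<close> and
  lines with \<^const>\<open>Inr\<close>.
\<close>

definition point_line_graph ::
    "nat \<Rightarrow> nat \<Rightarrow> ((nat \<Rightarrow> 'a::field) + (nat \<Rightarrow> 'a)) pair_pre_digraph" where
  "point_line_graph p m =
    (let A = {(Inl P, Inr L) | P L.
               P \<in> coord_space (m+1) \<and> L \<in> coord_space (m+1) \<and> incident p m P L}
     in \<lparr> pverts = coord_space (m+1) <+> coord_space (m+1), parcs = A \<union> A\<inverse> \<rparr>)"

lemma pair_graph_point_line_graph:
  "pair_graph (point_line_graph p m ::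
     ((nat \<Rightarrow> 'a::{field,finite}) + (nat \<Rightarrow> 'a)) pair_pre_digraph)" (is "pair_graph ?G")
proof -
  have fin: "finite (pverts ?G)"
    by (simp add: point_line_graph_def Let_def coord_space_def finite_PiE)
  have sub: "parcs ?G \<subseteq> pverts ?G \<times> pverts ?G"
    by (auto simp: point_line_graph_def Let_def)
  have "finite (parcs ?G)"
    using finite_subset[OF sub] fin by blast
  moreover have "symmetric (with_proj ?G)"
    by (auto simp: symmetric_def sym_def point_line_graph_def Let_def)
  moreover have "fst a \<noteq> snd a" if "a \<in> parcs ?G" for a
    using that by (auto simp: point_line_graph_def Let_def)
  ultimately show ?thesis
    using fin sub by unfold_locales auto
qed

end

theory Submission
  imports Defs "HOL-Number_Theory.Residues"
begin

text \<open>
  If points \<open>P, P'\<close> share two lines \<open>L, L'\<close>, the \<open>k = 2\<close> equations give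
  \<open>(p\<^sub>1 - p'\<^sub>1) (l\<^sub>1 - l'\<^sub>1) = 0\<close>, and equality of first coordinates forces equality
  of the remaining ones; so there is no 4-cycle, and bipartiteness excludes lengths 3 and 5.

  For a 6-cycle, take distinct field elements \<open>a, b, c\<close> fixed by all the powers
  \<open>t \<mapsto> t ^ p ^ (k - 2)\<close> involved: \<open>1, 0, -1\<close> if \<open>p\<close> is odd, and any three elements if
  \<open>m = 1\<close>. Point \<open>u\<close> has coordinates \<open>(u, -vw, \<dots>, -vw)\<close> and line \<open>u\<close> has
  \<open>[u, u(v+w), \<dots>, u(v+w)]\<close>, where \<open>{u, v, w} = {a, b, c}\<close>. As \<open>v(u+w) - vw = uv\<close>, point
  \<open>u\<close> lies on line \<open>v\<close> whenever \<open>u \<noteq> v\<close>, and \<open>K\<^sub>3\<^sub>,\<^sub>3\<close> minus a perfect matching is a hexagon.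
\<close>

lemma arc_point_line_graph_iff:
  "a \<in> parcs (point_line_graph p m) \<longleftrightarrow>
    (\<exists>P L. P \<in> coord_space (m+1) \<and> L \<in> coord_space (m+1) \<and> incident p m P L \<and>
       (a = (Inl P, Inr L) \<or> a = (Inr L, Inl P)))"
  by (auto simp: point_line_graph_def Let_def)

lemma coord_space_eqI:
  assumes "P \<in> coord_space (m+1)" "Q \<in> coord_space (m+1)"
    and "P 1 = Q 1" and "\<And>k. k \<in> {2..m+1} \<Longrightarrow> P k = Q k"
  shows "P = Q"
proof (rule PiE_ext)
  show "P \<in> {1..m+1} \<rightarrow>\<^sub>E UNIV" "Q \<in> {1..m+1} \<rightarrow>\<^sub>E UNIV"
    using assms(1,2) by (simp_all add: coord_space_def)
  show "P k = Q k" if "k \<in> {1..m+1}" for k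
    using assms(3,4) that by (cases "k = 1") auto
qed

lemma common_neighbours_eq:
  fixes P P' L L' :: "nat \<Rightarrow> 'a::field"
  assumes "m \<ge> 1"
    and "P \<in> coord_space (m+1)" "P' \<in> coord_space (m+1)"
    and "L \<in> coord_space (m+1)" "L' \<in> coord_space (m+1)"
    and inc: "incident p m P L" "incident p m P' L" "incident p m P L'" "incident p m P' L'"
  shows "P = P' \<or> L = L'"
proof (cases "P 1 = P' 1")
  case True
  have "P k = P' k" if "k \<in> {2..m+1}" for k
  proof -
    have "L k + P k = L k + P' k"
      using inc that True by (simp add: incident_def)
    then show ?thesis by simp
  qed
  with True show ?thesis using assms(2,3) coord_space_eqI by blast
next
  case False
  have "2 \<in> {2..m+1}" using \<open>m \<ge> 1\<close> by simp
  then have "L 2 + P 2 = P 1 * L 1" "L 2 + P' 2 = P' 1 * L 1"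
    "L' 2 + P 2 = P 1 * L' 1" "L' 2 + P' 2 = P' 1 * L' 1"
    using inc unfolding incident_def by fastforce+
  \<comment> \<open>Subtracting the two equations of one line cancels its second coordinate, so both
    lines yield the same difference \<open>P 2 - P' 2\<close>.\<close>
  then have "P 1 * L 1 - P' 1 * L 1 = P 2 - P' 2" "P 1 * L' 1 - P' 1 * L' 1 = P 2 - P' 2"
    by (metis add_diff_cancel_left)+
  then have "(P 1 - P' 1) * L 1 = (P 1 - P' 1) * L' 1"
    by (simp add: left_diff_distrib)
  with False have L1: "L 1 = L' 1" by simp
  have "L k = L' k" if "k \<in> {2..m+1}" for k
  proof -
    have "L k + P k = L' k + P k"
      using inc that L1 by (simp add: incident_def)
    then show ?thesis by simp
  qed
  with L1 show ?thesis using assms(4,5) coord_space_eqI by blast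
qed

text \<open>Every arc switches between points (\<open>Inl\<close>) and lines (\<open>Inr\<close>).
  Applied with \<open>u = v\<close>, this makes closed walks even.\<close>

lemma walk_parity:
  assumes "pcas u c v" and "set c \<subseteq> parcs (point_line_graph p m)"
  shows "isl v \<longleftrightarrow> (isl u \<longleftrightarrow> even (length c))"
  using assms by (induction u c v rule: pcas.induct) (auto simp: arc_point_line_graph_iff)

lemma cycle_length_ge_6:
  fixes p m :: nat
  defines "G \<equiv> (point_line_graph p m :: ((nat \<Rightarrow> 'a::field) + (nat \<Rightarrow> 'a)) pair_pre_digraph)"
  assumes "m \<ge> 1" and cyc: "pre_digraph.cycle (with_proj G) c" and "length c \<ge> 3"
  shows "length c \<ge> 6"
proof (rule ccontr)
  assume "\<not> length c \<ge> 6"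
  from cyc obtain u where walk: "pcas u c u" and sub: "set c \<subseteq> parcs G"
    and dist: "distinct (tl (pawalk_verts u c))"
    unfolding pre_digraph.cycle_def pre_digraph.awalk_def cas_with_proj_eq awalk_verts_with_proj_eq
    by auto
  have "even (length c)"
    using walk_parity[OF walk sub[unfolded G_def]] by blast
  with \<open>length c \<ge> 3\<close> \<open>\<not> length c \<ge> 6\<close> have "length c = 4"
    by presburger
  then obtain e1 e2 e3 e4 where "c = [e1, e2, e3, e4]"
    by (auto simp: numeral_eq_Suc length_Suc_conv)
  with walk obtain w1 w2 w3 where c: "c = [(u, w1), (w1, w2), (w2, w3), (w3, u)]"
    by (cases e1; cases e2; cases e3; cases e4) auto
  \<comment> \<open>The tail of the vertex list is \<open>[w1, w2, w3, u]\<close>; dropping the head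
    removes the repeated start vertex.\<close>
  have "w1 \<noteq> w3" "u \<noteq> w2"
    using dist by (auto simp: c)
  have arcs: "(u, w1) \<in> parcs G" "(w1, w2) \<in> parcs G" "(w2, w3) \<in> parcs G" "(w3, u) \<in> parcs G"
    using sub by (simp_all add: c)
  show False
  proof (cases u)
    case (Inl P)
    with arcs obtain L P' L' where "w1 = Inr L" "w2 = Inl P'" "w3 = Inr L'"
      unfolding G_def arc_point_line_graph_iff by blast
    with Inl arcs have "P = P' \<or> L = L'"
      unfolding G_def arc_point_line_graph_iff
      by (intro common_neighbours_eq[OF \<open>m \<ge> 1\<close>, where p = p]) auto
    then show False
      using \<open>w1 \<noteq> w3\<close> \<open>u \<noteq> w2\<close> Inl \<open>w1 = Inr L\<close> \<open>w2 = Inl P'\<close> \<open>w3 = Inr L'\<close> by simp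
  next
    case (Inr L)
    with arcs obtain P L' P' where "w1 = Inl P" "w2 = Inr L'" "w3 = Inl P'"
      unfolding G_def arc_point_line_graph_iff by blast
    with Inr arcs have "P = P' \<or> L = L'"
      unfolding G_def arc_point_line_graph_iff
      by (intro common_neighbours_eq[OF \<open>m \<ge> 1\<close>, where p = p]) auto
    then show False
      using \<open>w1 \<noteq> w3\<close> \<open>u \<noteq> w2\<close> Inr \<open>w1 = Inl P\<close> \<open>w2 = Inr L'\<close> \<open>w3 = Inl P'\<close> by simp
  qed
qed

definition hex_point :: "nat \<Rightarrow> 'a::field \<Rightarrow> 'a \<Rightarrow> 'a \<Rightarrow> nat \<Rightarrow> 'a" where
  "hex_point m a b c = (\<lambda>k\<in>{1..m+1}. if k = 1 then a else - (b * c))"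

definition hex_line :: "nat \<Rightarrow> 'a::field \<Rightarrow> 'a \<Rightarrow> 'a \<Rightarrow> nat \<Rightarrow> 'a" where
  "hex_line m a b c = (\<lambda>k\<in>{1..m+1}. if k = 1 then a else a * (b + c))"

text \<open>Only \<open>a\<close> has to be fixed by the powers, because incidence raises the first
  coordinate of the point but not that of the line.\<close>

lemma hex_arcs:
  assumes "\<forall>k\<in>{2..m+1}. a ^ p ^ (k - 2) = a"
  shows "(Inl (hex_point m a b c), Inr (hex_line m b a c)) \<in> parcs (point_line_graph p m)"
    "(Inr (hex_line m b a c), Inl (hex_point m a b c)) \<in> parcs (point_line_graph p m)"
    "(Inl (hex_point m a b c), Inr (hex_line m c a b)) \<in> parcs (point_line_graph p m)"
    "(Inr (hex_line m c a b), Inl (hex_point m a b c)) \<in> parcs (point_line_graph p m)"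
  using assms
  by (auto simp: arc_point_line_graph_iff incident_def hex_point_def hex_line_def
      coord_space_def algebra_simps)

lemma hex_point_1 [simp]: "hex_point m a b c (Suc 0) = a"
  and hex_line_1 [simp]: "hex_line m a b c (Suc 0) = a"
  by (simp_all add: hex_point_def hex_line_def)

lemma exists_cycle_length_6:
  fixes a b c :: "'a::field" and p m :: nat
  defines "G \<equiv> (point_line_graph p m :: ((nat \<Rightarrow> 'a) + (nat \<Rightarrow> 'a)) pair_pre_digraph)"
  assumes dist: "distinct [a, b, c]"
    and fixed: "\<forall>k\<in>{2..m+1}. a ^ p ^ (k - 2) = a" "\<forall>k\<in>{2..m+1}. b ^ p ^ (k - 2) = b"
      "\<forall>k\<in>{2..m+1}. c ^ p ^ (k - 2) = c"
  shows "\<exists>C. pre_digraph.cycle (with_proj G) C \<and> length C = 6"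
proof -
  \<comment> \<open>Each line bears the label missing from the two points it joins: \<open>X\<close>
    (label \<open>c\<close>) joins \<open>A\<close> and \<open>B\<close>, \<open>Y\<close> joins
    \<open>B\<close> and \<open>C\<close>, \<open>Z\<close> joins \<open>C\<close> and
    \<open>A\<close>.\<close>
  define A B C where "A = hex_point m a b c" and "B = hex_point m b c a"
    and "C = hex_point m c a b"
  define X Y Z where "X = hex_line m c a b" and "Y = hex_line m a b c"
    and "Z = hex_line m b c a"
  note defs = A_def B_def C_def X_def Y_def Z_def
  \<comment> \<open>The last two arguments may be swapped, which reconciles the argument orders in
    \<open>hex_arcs\<close> with those of \<open>X\<close>, \<open>Y\<close>,
    \<open>Z\<close>.\<close>
  have "hex_line m u v w = hex_line m u w v" for u v w :: 'a
    unfolding hex_line_def by (subst add.commute[of v w]) (rule refl)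
  then have arcs: "(Inl A, Inr X) \<in> parcs G" "(Inr X, Inl B) \<in> parcs G"
    "(Inl B, Inr Y) \<in> parcs G" "(Inr Y, Inl C) \<in> parcs G"
    "(Inl C, Inr Z) \<in> parcs G" "(Inr Z, Inl A) \<in> parcs G"
    unfolding defs G_def using hex_arcs fixed by metis+
  have "A 1 = a" "B 1 = b" "C 1 = c" "X 1 = c" "Y 1 = a" "Z 1 = b"
    by (simp_all add: defs)
  then have "distinct [A, B, C]" "distinct [X, Y, Z]" using dist by auto
  moreover have "Inl A \<in> pverts G"
    by (auto simp: G_def point_line_graph_def Let_def A_def hex_point_def coord_space_def)
  ultimately have "pre_digraph.cycle (with_proj G)
      [(Inl A, Inr X), (Inr X, Inl B), (Inl B, Inr Y), (Inr Y, Inl C), (Inl C, Inr Z), (Inr Z, Inl A)]"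
    using arcs
    unfolding pre_digraph.cycle_def pre_digraph.awalk_def cas_with_proj_eq awalk_verts_with_proj_eq
    by (auto intro!: exI[of _ "Inl A"])
  then show ?thesis by (auto intro!: exI)
qed

text \<open>If \<open>1 = - 1\<close> then \<open>2 = 0\<close>, so an odd cardinality maps to
  \<open>1\<close> in the field; but it maps to \<open>0\<close>, being a multiple of the
  characteristic.\<close>

lemma one_neq_minus_one_if_odd_CARD:
  assumes "odd CARD('a::{field,finite})"
  shows "(1 :: 'a) \<noteq> - 1"
proof
  assume "(1 :: 'a) = - 1"
  then have two: "(2 :: 'a) = 0" by (metis add.right_inverse one_add_one)
  obtain n where "CARD('a) = 2 * n + 1" using assms by (rule oddE)
  with two have "of_nat CARD('a) = (1 :: 'a)" by simp
  then show False using CHAR_dvd_CARD[where 'a='a] by (simp add: of_nat_eq_0_iff_char_dvd[symmetric])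
qed

lemma exists_distinct3:
  assumes "card A \<ge> 3"
  shows "\<exists>a b c. distinct [a, b, c] \<and> {a, b, c} \<subseteq> A"
  using assms by (auto simp: numeral_eq_Suc card_le_Suc_iff)

theorem theorem5p3:
  fixes p e q m :: nat
  assumes "prime p" and "q = p ^ e" and "CARD('a::{field,finite}) = q"
    and "(m \<ge> 1 \<and> e \<ge> 1 \<and> odd p) \<or> (m = 1 \<and> e \<ge> 2 \<and> p = 2)"
  shows "girth (with_proj (point_line_graph p m ::
           ((nat \<Rightarrow> 'a) + (nat \<Rightarrow> 'a)) pair_pre_digraph)) = 6"
proof -
  let ?G = "with_proj (point_line_graph p m :: ((nat \<Rightarrow> 'a) + (nat \<Rightarrow> 'a)) pair_pre_digraph)"
  have "m \<ge> 1" using assms(4) by auto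
  have "\<exists>a b c :: 'a. distinct [a, b, c] \<and>
    (\<forall>t\<in>{a, b, c}. \<forall>k\<in>{2..m+1}. t ^ p ^ (k - 2) = t)"
    using assms(4)
  proof (elim disjE conjE)
    assume "odd p"
    then have "odd CARD('a)" using assms(2,3) by simp
    then have "distinct [1, 0, - 1 :: 'a]" using one_neq_minus_one_if_odd_CARD by auto
    \<comment> \<open>The exponents are powers of an odd prime, hence odd and positive: they fix
      \<open>- 1\<close> and \<open>0\<close>.\<close>
    moreover have "\<forall>t\<in>{1, 0, - 1 :: 'a}. \<forall>k\<in>{2..m+1}. t ^ p ^ (k - 2) = t"
      using \<open>odd p\<close> by (auto simp: zero_power prime_gt_0_nat[OF assms(1)])
    ultimately show ?thesis by blast
  next
    assume "m = 1" "e \<ge> 2" "p = 2"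
    then have "2 ^ 2 \<le> CARD('a)"
      using assms(2,3) power_increasing[of 2 e "2::nat"] by simp
    then obtain a b c :: 'a where "distinct [a, b, c]"
      using exists_distinct3[of "UNIV :: 'a set"] by auto
    \<comment> \<open>For \<open>m = 1\<close> only \<open>k = 2\<close> occurs, with exponent
      \<open>p ^ 0 = 1\<close>, which fixes every element.\<close>
    then show ?thesis using \<open>m = 1\<close> by (intro exI[of _ a] exI[of _ b] exI[of _ c]) auto
  qed
  then obtain C where "pre_digraph.cycle ?G C" "length C = 6"
    using exists_cycle_length_6[of _ _ _ m p] by force
  then have "girth ?G \<le> 6"
    unfolding girth_def by (intro INF_lower2[of C]) (auto simp: numeral_eq_enat)
  moreover have "6 \<le> girth ?G"
    unfolding girth_def using cycle_length_ge_6[OF \<open>m \<ge> 1\<close>]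
    by (intro INF_greatest) (auto simp: numeral_eq_enat)
  ultimately show ?thesis by simp
qed

end
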